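(* Let $k\ge 2$ be an integer and let $G$ be a $(k;\,5,4)$-graph, that is, a $k$-regular graph with girth $5$ and diameter $4$. Then $|V(G)| \ge k^2+k+2$. In other words, $n_0(k;\,5,4)\ge k^2+k+2$ for every $k$ for which a $(k;\,5,4)$-graph exists.
   Context: Graphs are finite, simple and undirected. The order of a graph is its number of vertices; its diameter is the maximum distance between a pair of its vertices (so a graph of finite diameter is connected); its girth is the length of its smallest circuit. For integers $k\ge 2$, $g\ge 3$, $d\ge 1$, a $(k;\,g,d)$-graph is a $k$-regular graph with girth $g$ and diameter $d$, and $n_0(k;\,g,d)$ denotes the smallest possible order of such a graph, if one exists. *)

theory Defs
  imports "Graph_Theory.Graph_Theory" "HOL-Library.Extended_Nat"
begin

text \<open>
  Finite simple undirected graphs are rendered by the locale \<open>graph\<close> of the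
  entry \<open>Graph_Theory\<close>: finite, loop-free, without parallel arcs, and symmetric, so
  that each edge is represented by a pair of opposite arcs.
\<close>

definition graph_order :: "('a, 'b) pre_digraph \<Rightarrow> nat" where
  "graph_order G = card (verts G)"

text \<open>
  As arcs come in opposite pairs, the degree of a vertex is its out-degree.
\<close>
definition regular :: "nat \<Rightarrow> ('a, 'b) pre_digraph \<Rightarrow> bool" where
  "regular k G \<longleftrightarrow> (\<forall>v \<in> verts G. out_degree G v = k)"

text \<open>
  A library cycle may run back and forth along a single edge, which is a
  closed walk of length 2 but not a circuit of an undirected graph. In a simple graph
  the circuits are exactly the library cycles of length at least 3. The girth of a
  graph without circuits is \<open>\<infinity>\<close>.
\<close>
definition circuit :: "('a, 'b) pre_digraph \<Rightarrow> 'b awalk \<Rightarrow> bool" where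
  "circuit G p \<longleftrightarrow> pre_digraph.cycle G p \<and> 3 \<le> length p"

definition girth :: "('a, 'b) pre_digraph \<Rightarrow> enat" where
  "girth G = (INF p \<in> {p. circuit G p}. enat (length p))"

text \<open>
  The distance is the minimum cost of a walk when each arc has cost 1; it is \<open>\<infinity>\<close> if there
  is no walk. Hence a finite diameter entails connectedness.
\<close>
definition graph_dist :: "('a, 'b) pre_digraph \<Rightarrow> 'a \<Rightarrow> 'a \<Rightarrow> ereal" where
  "graph_dist G u v = wf_digraph.\<mu> G (\<lambda>_. 1) u v"

definition graph_diameter :: "('a, 'b) pre_digraph \<Rightarrow> ereal" where
  "graph_diameter G = (SUP (u, v) \<in> verts G \<times> verts G. graph_dist G u v)"

definition kgd_graph :: "nat \<Rightarrow> nat \<Rightarrow> nat \<Rightarrow> ('a, 'b) pre_digraph \<Rightarrow> bool" where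
  "kgd_graph k g d G \<longleftrightarrow>
     graph G \<and> regular k G \<and> girth G = enat g \<and> graph_diameter G = ereal (real d)"

text \<open>
  The minimum is taken over graphs whose vertices are natural numbers and whose arcs are
  pairs of them; every finite simple graph is isomorphic to one of these. The value is
  meaningful only if a graph with the given parameters exists.
\<close>
definition n0 :: "nat \<Rightarrow> nat \<Rightarrow> nat \<Rightarrow> nat" where
  "n0 k g d = (LEAST n. \<exists>G :: (nat, nat \<times> nat) pre_digraph. kgd_graph k g d G \<and> graph_order G = n)"

end

theory Submission
  imports Defs
begin

text \<open>
  The diameter supplies two vertices \<open>u\<close> and \<open>v\<close> at distance more than 3. As there are no
  circuits of length 3 or 4, distinct walks of length at most 2 from \<open>u\<close> that do not turn
  back have distinct ends, so the ball of radius 2 around \<open>u\<close> has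
  \<open>1 + k + k * (k - 1) = k\<^sup>2 + 1\<close> vertices (lemma \<open>card_ball_2\<close>). The closed neighbourhood
  of \<open>v\<close> has \<open>k + 1\<close> vertices, and it is disjoint from this ball: a common vertex
  would yield a walk of length at most 3 from \<open>u\<close> to \<open>v\<close>. Adding up gives \<open>k\<^sup>2 + k + 2\<close>
  (lemma \<open>order_lower_bound\<close>).

  The number \<open>n0 k 5 4\<close> is a minimum over graphs on natural numbers. It is
  attained, because some graph on natural numbers has the required parameters: relabel
  \<open>G\<close> (lemma \<open>kgd_graph_nat_copy\<close>), noting that degree, girth and diameter are invariant
  under isomorphism. The bound then applies to a graph that attains the minimum.
\<close>

section \<open>Neighbourhoods and short circuits\<close>

definition nbrs :: "('a, 'b) pre_digraph \<Rightarrow> 'a \<Rightarrow> 'a set" where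
  "nbrs G v = {w. v \<rightarrow>\<^bsub>G\<^esub> w}"

lemma nbrs_sub_verts: "wf_digraph G \<Longrightarrow> nbrs G v \<subseteq> verts G"
  unfolding nbrs_def using wf_digraph.adj_in_verts by fastforce

lemma (in fin_digraph) finite_nbrs: "finite (nbrs G v)"
  using nbrs_sub_verts[OF wf_digraph] finite_verts by (rule finite_subset)

text \<open>Parallel arcs would count several times in the degree but only once here.\<close>
lemma (in nomulti_digraph) card_nbrs: "card (nbrs G v) = out_degree G v"
proof -
  have "nbrs G v = head G ` out_arcs G v"
    unfolding nbrs_def arcs_ends_conv out_arcs_def by auto
  moreover have "inj_on (head G) (out_arcs G v)"
    by (rule inj_onI) (auto intro!: no_multi_arcs simp: arc_to_ends_def)
  ultimately show ?thesis
    by (simp add: card_image out_degree_def)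
qed

lemma (in graph) nbrs_sym: "w \<in> nbrs G v \<longleftrightarrow> v \<in> nbrs G w"
  using symD[OF sym_arcs[unfolded symmetric_def]] unfolding nbrs_def by auto

lemma (in loopfree_digraph) nbrs_irrefl: "v \<notin> nbrs G v"
  unfolding nbrs_def using adj_not_same by auto

lemma girth_le_circuit: "circuit G p \<Longrightarrow> girth G \<le> enat (length p)"
  unfolding girth_def by (rule INF_lower) simp

lemma (in wf_digraph) nbrsE:
  assumes "w \<in> nbrs G v"
  obtains e where "e \<in> arcs G" "tail G e = v" "head G e = w"
  using assms unfolding nbrs_def arcs_ends_conv by auto

lemma (in loopfree_digraph) triangle_girth:
  assumes ab: "b \<in> nbrs G a" and bc: "c \<in> nbrs G b" and ca: "a \<in> nbrs G c"
  shows "girth G \<le> 3"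
proof -
  obtain e1 where e1: "e1 \<in> arcs G" "tail G e1 = a" "head G e1 = b" using ab by (rule nbrsE)
  obtain e2 where e2: "e2 \<in> arcs G" "tail G e2 = b" "head G e2 = c" using bc by (rule nbrsE)
  obtain e3 where e3: "e3 \<in> arcs G" "tail G e3 = c" "head G e3 = a" using ca by (rule nbrsE)
  have "a \<noteq> b" "b \<noteq> c" "c \<noteq> a" using ab bc ca nbrs_irrefl by auto
  then have "awalk a [e1, e2, e3] a" "distinct (tl (awalk_verts a [e1, e2, e3]))"
    using e1 e2 e3 tail_in_verts head_in_verts by (auto simp: awalk_simps)
  then have "circuit G [e1, e2, e3]"
    unfolding circuit_def cycle_def by auto
  from girth_le_circuit[OF this] show ?thesis by (simp add: numeral_eq_enat eval_nat_numeral)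
qed

lemma (in loopfree_digraph) quadrilateral_girth:
  assumes ab: "b \<in> nbrs G a" and bc: "c \<in> nbrs G b" and cd: "d \<in> nbrs G c" and da: "a \<in> nbrs G d"
    and ne: "a \<noteq> c" "b \<noteq> d"
  shows "girth G \<le> 4"
proof -
  obtain e1 where e1: "e1 \<in> arcs G" "tail G e1 = a" "head G e1 = b" using ab by (rule nbrsE)
  obtain e2 where e2: "e2 \<in> arcs G" "tail G e2 = b" "head G e2 = c" using bc by (rule nbrsE)
  obtain e3 where e3: "e3 \<in> arcs G" "tail G e3 = c" "head G e3 = d" using cd by (rule nbrsE)
  obtain e4 where e4: "e4 \<in> arcs G" "tail G e4 = d" "head G e4 = a" using da by (rule nbrsE)
  have "a \<noteq> b" "b \<noteq> c" "c \<noteq> d" "d \<noteq> a" using ab bc cd da nbrs_irrefl by auto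
  then have "awalk a [e1, e2, e3, e4] a" "distinct (tl (awalk_verts a [e1, e2, e3, e4]))"
    using e1 e2 e3 e4 ne tail_in_verts head_in_verts by (auto simp: awalk_simps)
  then have "circuit G [e1, e2, e3, e4]"
    unfolding circuit_def cycle_def by auto
  from girth_le_circuit[OF this] show ?thesis by (simp add: numeral_eq_enat eval_nat_numeral)
qed

section \<open>The ball of radius 2\<close>

definition ball_2 :: "('a, 'b) pre_digraph \<Rightarrow> 'a \<Rightarrow> 'a set" where
  "ball_2 G u = {u} \<union> nbrs G u \<union> (\<Union>w \<in> nbrs G u. nbrs G w - {u})"

text \<open>
  Each neighbour of \<open>u\<close> contributes \<open>k - 1\<close> vertices at distance 2: without triangles none of
  them is adjacent to \<open>u\<close>, and without quadrilaterals no two neighbours of \<open>u\<close> contribute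
  the same one.
\<close>
lemma (in graph) card_ball_2:
  assumes reg: "regular k G" and girth: "girth G \<ge> 5" and u: "u \<in> verts G"
  shows "card (ball_2 G u) = k\<^sup>2 + 1"
proof -
  let ?S = "\<Union>w \<in> nbrs G u. nbrs G w - {u}"
  have no34: "\<not> girth G \<le> 3" "\<not> girth G \<le> 4"
    using girth by (auto simp: numeral_eq_enat dest: order_trans)
  have deg: "card (nbrs G w) = k" if "w \<in> verts G" for w
    using reg that by (simp add: regular_def card_nbrs)
  have card1: "card (nbrs G w - {u}) = k - 1" if "w \<in> nbrs G u" for w
  proof -
    have "w \<in> verts G" using that nbrs_sub_verts[OF wf_digraph] by auto
    moreover have "u \<in> nbrs G w" using that nbrs_sym by auto
    ultimately show ?thesis by (simp add: deg)
  qed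
  have disj: "(nbrs G w - {u}) \<inter> (nbrs G w' - {u}) = {}"
    if w: "w \<in> nbrs G u" and w': "w' \<in> nbrs G u" and ne: "w \<noteq> w'" for w w'
  proof (rule ccontr)
    assume "\<not> ?thesis"
    then obtain x where "x \<in> nbrs G w" "x \<in> nbrs G w'" "x \<noteq> u" by auto
    then show False
      using quadrilateral_girth[of w u x w'] w w' ne nbrs_sym no34 by blast
  qed
  have "card ?S = (\<Sum>w \<in> nbrs G u. card (nbrs G w - {u}))"
    by (rule card_UN_disjoint) (use disj finite_nbrs in auto)
  also have "\<dots> = k * (k - 1)" using card1 deg[OF u] by simp
  finally have cS: "card ?S = k * (k - 1)" .
  have fin: "finite (nbrs G u)" "finite ?S" using finite_nbrs by auto
  have "nbrs G u \<inter> ?S = {}"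
    using triangle_girth[of _ u] nbrs_sym no34 by blast
  then have "card (nbrs G u \<union> ?S) = k + k * (k - 1)"
    using card_Un_disjoint[OF fin] cS deg[OF u] by simp
  moreover have "u \<notin> nbrs G u \<union> ?S" using nbrs_irrefl by auto
  ultimately have "card (ball_2 G u) = Suc (k + k * (k - 1))"
    using fin unfolding ball_2_def by simp
  also have "\<dots> = k\<^sup>2 + 1" by (cases k) (auto simp: power2_eq_square)
  finally show ?thesis .
qed

section \<open>The lower bound for a single graph\<close>

lemma (in wf_digraph) awalk_cost_1: "awalk_cost (\<lambda>_. 1) p = real (length p)"
  by (induction p) auto

lemma (in wf_digraph) graph_dist_le_awalk: "awalk u p v \<Longrightarrow> graph_dist G u v \<le> ereal (length p)"
  unfolding graph_dist_def using min_cost_le_walk_cost[of u p v "\<lambda>_. 1"] by (simp add: awalk_cost_1)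

lemma (in wf_digraph) ball_2_awalk:
  assumes "u \<in> verts G" "x \<in> ball_2 G u"
  obtains p where "awalk u p x" "length p \<le> 2"
proof -
  consider "x = u" | "x \<in> nbrs G u" | w where "w \<in> nbrs G u" "x \<in> nbrs G w"
    using assms(2) unfolding ball_2_def by auto
  then show ?thesis
  proof cases
    case 1
    then show ?thesis using assms(1) that[of "[]"] by (auto simp: awalk_simps)
  next
    case 2
    then obtain e where "e \<in> arcs G" "tail G e = u" "head G e = x" by (rule nbrsE)
    then show ?thesis using that[of "[e]"] by (auto simp: awalk_simps)
  next
    case 3
    obtain e where e: "e \<in> arcs G" "tail G e = u" "head G e = w" using 3(1) by (rule nbrsE)
    obtain f where "f \<in> arcs G" "tail G f = w" "head G f = x" using 3(2) by (rule nbrsE)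
    then show ?thesis using e that[of "[e, f]"] by (auto simp: awalk_simps)
  qed
qed

lemma (in graph) order_lower_bound:
  assumes reg: "regular k G" and girth: "girth G \<ge> 5" and diam: "graph_diameter G > ereal 3"
  shows "graph_order G \<ge> k\<^sup>2 + k + 2"
proof -
  obtain u v where u: "u \<in> verts G" and v: "v \<in> verts G" and far: "graph_dist G u v > ereal 3"
    using diam unfolding graph_diameter_def less_SUP_iff by auto
  have short: "\<not> length p \<le> 3" if "awalk u p v" for p
  proof
    assume "length p \<le> 3"
    then have "ereal (length p) \<le> ereal 3" by simp
    then show False using graph_dist_le_awalk[OF that] far by (meson leD order_trans)
  qed
  have disj: "ball_2 G u \<inter> insert v (nbrs G v) = {}"
  proof (rule ccontr)
    assume "\<not> ?thesis"
    then obtain x where x: "x \<in> ball_2 G u" "x = v \<or> v \<in> nbrs G x" using nbrs_sym by auto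
    obtain p where p: "awalk u p x" "length p \<le> 2" using ball_2_awalk[OF u x(1)] .
    from x(2) show False
    proof
      assume "x = v"
      then show False using p short[of p] by auto
    next
      assume "v \<in> nbrs G x"
      then obtain e where "e \<in> arcs G" "tail G e = x" "head G e = v" by (rule nbrsE)
      then have "awalk u (p @ [e]) v" using p by (auto simp: awalk_simps)
      then show False using short[of "p @ [e]"] p by auto
    qed
  qed
  have sub: "ball_2 G u \<union> insert v (nbrs G v) \<subseteq> verts G"
    using u v nbrs_sub_verts[OF wf_digraph] unfolding ball_2_def by blast
  then have "finite (ball_2 G u)" by (meson finite_Un finite_subset finite_verts)
  then have "card (ball_2 G u \<union> insert v (nbrs G v)) = (k\<^sup>2 + 1) + (k + 1)"
    using card_Un_disjoint[OF _ _ disj] card_ball_2[OF reg girth u] finite_nbrs nbrs_irrefl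
      reg v by (simp add: regular_def card_nbrs)
  then show ?thesis
    using card_mono[OF finite_verts sub] by (simp add: graph_order_def)
qed

corollary kgd_graph_order:
  assumes "kgd_graph k 5 4 G"
  shows "graph_order G \<ge> k\<^sup>2 + k + 2"
proof (rule graph.order_lower_bound)
  show "graph G" "regular k G" using assms by (auto simp: kgd_graph_def)
  show "girth G \<ge> 5" "graph_diameter G > ereal 3"
    using assms by (auto simp: kgd_graph_def numeral_eq_enat)
qed

section \<open>Invariance under isomorphism\<close>

text \<open>
  Walks and circuits are only pushed forward along an isomorphism, which gives inequalities;
  the inverse isomorphism turns them into equations.
\<close>

context wf_digraph begin

lemma girth_app_iso_le:
  assumes hom: "digraph_isomorphism hom"
  shows "girth (app_iso hom G) \<le> girth G"
  unfolding girth_def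
proof (rule INF_mono)
  fix p assume "p \<in> {p. circuit G p}"
  then obtain u where p: "awalk u p u" "distinct (tl (awalk_verts u p))" "p \<noteq> []" "3 \<le> length p"
    by (auto simp: circuit_def cycle_def)
  let ?q = "map (iso_arcs hom) p"
  have "set (tl (awalk_verts u p)) \<subseteq> verts G"
    using p(1) by (meson awalkE list.set_sel(2) subset_iff awalk_verts_non_Nil)
  then have "inj_on (iso_verts hom) (set (tl (awalk_verts u p)))"
    using digraph_isomorphism_inj_on_verts[OF hom] inj_on_subset by blast
  then have "distinct (tl (pre_digraph.awalk_verts (app_iso hom G) (iso_verts hom u) ?q))"
    using p(2) by (simp add: awalk_verts_app_iso_eq[OF hom p(1)] distinct_map flip: map_tl)
  then have "circuit (app_iso hom G) ?q"
    using awalk_app_isoI[OF p(1) hom] p(3,4) unfolding circuit_def pre_digraph.cycle_def by auto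
  then show "\<exists>q \<in> {p. circuit (app_iso hom G) p}. enat (length q) \<le> enat (length p)"
    by (intro bexI[of _ ?q]) auto
qed

lemma graph_dist_app_iso_le:
  assumes hom: "digraph_isomorphism hom"
  shows "graph_dist (app_iso hom G) (iso_verts hom u) (iso_verts hom v) \<le> graph_dist G u v"
proof -
  interpret H: wf_digraph "app_iso hom G" using hom ..
  show ?thesis
    unfolding graph_dist_def H.\<mu>_def \<mu>_def
  proof (rule INF_mono)
    fix p assume "p \<in> {p. awalk u p v}"
    then show "\<exists>q \<in> {p. H.awalk (iso_verts hom u) p (iso_verts hom v)}.
        ereal (H.awalk_cost (\<lambda>_. 1) q) \<le> ereal (awalk_cost (\<lambda>_. 1) p)"
      using awalk_app_isoI[OF _ hom] by (intro bexI[of _ "map (iso_arcs hom) p"]) (auto simp: awalk_cost_1 H.awalk_cost_1)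
  qed
qed

lemma graph_diameter_app_iso_le:
  assumes hom: "digraph_isomorphism hom"
  shows "graph_diameter (app_iso hom G) \<le> graph_diameter G"
  unfolding graph_diameter_def
proof (rule SUP_mono, safe)
  fix x y assume "x \<in> verts (app_iso hom G)" "y \<in> verts (app_iso hom G)"
  then obtain u v where "u \<in> verts G" "v \<in> verts G" "x = iso_verts hom u" "y = iso_verts hom v"
    by auto
  then show "\<exists>m \<in> verts G \<times> verts G.
      graph_dist (app_iso hom G) x y \<le> (case m of (u, v) \<Rightarrow> graph_dist G u v)"
    using graph_dist_app_iso_le[OF hom] by (intro bexI[of _ "(u, v)"]) auto
qed

lemma girth_app_iso:
  assumes hom: "digraph_isomorphism hom"
  shows "girth (app_iso hom G) = girth G"
proof -
  interpret H: wf_digraph "app_iso hom G" using hom ..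
  show ?thesis
    using girth_app_iso_le[OF hom] H.girth_app_iso_le[OF digraph_isomorphism_invI[OF hom]] hom
    by (simp add: antisym)
qed

lemma graph_diameter_app_iso:
  assumes hom: "digraph_isomorphism hom"
  shows "graph_diameter (app_iso hom G) = graph_diameter G"
proof -
  interpret H: wf_digraph "app_iso hom G" using hom ..
  show ?thesis
    using graph_diameter_app_iso_le[OF hom]
      H.graph_diameter_app_iso_le[OF digraph_isomorphism_invI[OF hom]] hom
    by (simp add: antisym)
qed

end

lemma (in graph) graph_app_iso:
  assumes hom: "digraph_isomorphism hom"
  shows "graph (app_iso hom G)"
proof -
  interpret H: fin_digraph "app_iso hom G" using hom ..
  show ?thesis
  proof
    fix e assume "e \<in> arcs (app_iso hom G)"
    then show "tail (app_iso hom G) e \<noteq> head (app_iso hom G) e"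
      using no_loops hom by (auto simp: iso_verts_head iso_verts_tail)
  next
    fix e f assume "e \<in> arcs (app_iso hom G)" "f \<in> arcs (app_iso hom G)"
      "arc_to_ends (app_iso hom G) e = arc_to_ends (app_iso hom G) f"
    then show "e = f"
      using hom no_multi_arcs by (auto simp: arc_to_ends_def iso_verts_head iso_verts_tail)
  next
    have "symmetric G" ..
    then show "symmetric (app_iso hom G)"
      using hom unfolding symmetric_conv by (fastforce simp: iso_verts_head iso_verts_tail)
  qed
qed

lemma kgd_graph_app_iso:
  assumes G: "kgd_graph k g d G" and hom: "pre_digraph.digraph_isomorphism G hom"
  shows "kgd_graph k g d (app_iso hom G)"
proof -
  interpret graph G using G by (simp add: kgd_graph_def)
  have "regular k (app_iso hom G)"
    using G out_degree_app_iso_eq[OF hom] unfolding kgd_graph_def regular_def by auto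
  then show ?thesis
    using G graph_app_iso[OF hom] girth_app_iso[OF hom] graph_diameter_app_iso[OF hom]
    by (simp add: kgd_graph_def)
qed

lemma kgd_graph_nat_copy:
  assumes G: "kgd_graph k g d G"
  shows "\<exists>H :: (nat, nat \<times> nat) pre_digraph. kgd_graph k g d H"
proof -
  interpret graph G using G by (simp add: kgd_graph_def)
  obtain f :: "'a \<Rightarrow> nat" where f: "inj_on f (verts G)"
    using finite_imp_inj_to_nat_seg[OF finite_verts] by blast
  let ?hom = "\<lparr> iso_verts = f, iso_arcs = (\<lambda>e. (f (tail G e), f (head G e))),
    iso_head = snd, iso_tail = fst \<rparr>"
  have "inj_on (\<lambda>e. (f (tail G e), f (head G e))) (arcs G)"
    by (rule inj_onI) (auto intro!: no_multi_arcs simp: arc_to_ends_def inj_on_eq_iff[OF f])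
  then have "digraph_isomorphism ?hom"
    using f wf_digraph by (simp add: digraph_isomorphism_def)
  then show ?thesis using kgd_graph_app_iso[OF G] by blast
qed

theorem mainTheorem1:
  fixes k :: nat and G :: "('a, 'b) pre_digraph"
  assumes "k \<ge> 2"
    and "kgd_graph k 5 4 G"
  shows "graph_order G \<ge> k\<^sup>2 + k + 2 \<and> n0 k 5 4 \<ge> k\<^sup>2 + k + 2"
proof
  show "graph_order G \<ge> k\<^sup>2 + k + 2" using assms(2) by (rule kgd_graph_order)
  have "\<exists>n. \<exists>H :: (nat, nat \<times> nat) pre_digraph. kgd_graph k 5 4 H \<and> graph_order H = n"
    using kgd_graph_nat_copy[OF assms(2)] by blast
  then have "\<exists>H :: (nat, nat \<times> nat) pre_digraph. kgd_graph k 5 4 H \<and> graph_order H = n0 k 5 4"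
    unfolding n0_def by (rule LeastI_ex)
  then show "n0 k 5 4 \<ge> k\<^sup>2 + k + 2" using kgd_graph_order by metis
qed

end
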